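(* For any $\omega\in(0,\infty)$ and all $\xi\in\mathbb R$ it holds that $$\widetilde{\mathcal Q}_{1,\omega}(\xi)=(\omega-\xi^2)\,\frac{1}{24\sqrt\pi}\,\frac{\xi^2(\omega+\xi^2)}{\omega^2(|\xi|+i\sqrt\omega)^2}\,\operatorname{sech}\Bigl(\frac\pi2\frac{\xi}{\sqrt\omega}\Bigr).$$ In particular, $\widetilde{\mathcal Q}_{1,\omega}(\pm\sqrt\omega)=0$.
   Context: For $\omega>0$ let $\phi_\omega(x):=\sqrt{2\omega}\operatorname{sech}(\sqrt\omega x)$ and $$\Psi_{1,\omega}(x,\xi):=\frac{1}{\sqrt{2\pi}}\frac{(\xi+i\sqrt\omega\tanh(\sqrt\omega x))^2}{(|\xi|-i\sqrt\omega)^2}e^{ix\xi},\qquad \Psi_{2,\omega}(x,\xi):=\frac{1}{\sqrt{2\pi}}\frac{(\sqrt\omega\operatorname{sech}(\sqrt\omega x))^2}{(|\xi|-i\sqrt\omega)^2}e^{ix\xi}.$$ Set $\Phi_{1,\omega}(x):=\Psi_{1,\omega}(x,0)=\frac{1}{\sqrt{2\pi}}\tanh^2(\sqrt\omega x)$, $\Phi_{2,\omega}(x):=\Psi_{2,\omega}(x,0)=-\frac{1}{\sqrt{2\pi}}\operatorname{sech}^2(\sqrt\omega x)$, and $$\mathcal Q_{1,\omega}(x):=\begin{bmatrix}-\phi_\omega(x)\bigl(\Phi_{1,\omega}(x)^2+2\Phi_{1,\omega}(x)\Phi_{2,\omega}(x)\bigr)\\ \phi_\omega(x)\bigl(\Phi_{2,\omega}(x)^2+2\Phi_{1,\omega}(x)\Phi_{2,\omega}(x)\bigr)\end{bmatrix}.$$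 For $F=(f_1,f_2)^\top$ the plus-component of the distorted Fourier transform is $\widetilde{\mathcal F}_{+,\omega}[F](\xi):=\int_{\mathbb R}\bigl(f_1(x)\overline{\Psi_{1,\omega}(x,\xi)}-f_2(x)\overline{\Psi_{2,\omega}(x,\xi)}\bigr)dx$, and $\widetilde{\mathcal Q}_{1,\omega}(\xi):=\widetilde{\mathcal F}_{+,\omega}[\mathcal Q_{1,\omega}](\xi)$. *)

theory Defs
  imports "HOL-Analysis.Analysis"
begin

definition sech :: "real \<Rightarrow> real" where
  "sech x = 1 / cosh x"

definition phi :: "real \<Rightarrow> real \<Rightarrow> real" where
  "phi \<omega> x = sqrt (2 * \<omega>) * sech (sqrt \<omega> * x)"

definition Psi1 :: "real \<Rightarrow> real \<Rightarrow> real \<Rightarrow> complex" where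
  "Psi1 \<omega> x \<xi> =
     1 / complex_of_real (sqrt (2 * pi))
     * ((complex_of_real \<xi> + \<i> * complex_of_real (sqrt \<omega> * tanh (sqrt \<omega> * x)))\<^sup>2
        / (complex_of_real \<bar>\<xi>\<bar> - \<i> * complex_of_real (sqrt \<omega>))\<^sup>2)
     * exp (\<i> * complex_of_real (x * \<xi>))"

definition Psi2 :: "real \<Rightarrow> real \<Rightarrow> real \<Rightarrow> complex" where
  "Psi2 \<omega> x \<xi> =
     1 / complex_of_real (sqrt (2 * pi))
     * ((complex_of_real (sqrt \<omega> * sech (sqrt \<omega> * x)))\<^sup>2
        / (complex_of_real \<bar>\<xi>\<bar> - \<i> * complex_of_real (sqrt \<omega>))\<^sup>2)
     * exp (\<i> * complex_of_real (x * \<xi>))"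

definition Phi1 :: "real \<Rightarrow> real \<Rightarrow> complex" where
  "Phi1 \<omega> x = Psi1 \<omega> x 0"

definition Phi2 :: "real \<Rightarrow> real \<Rightarrow> complex" where
  "Phi2 \<omega> x = Psi2 \<omega> x 0"

lemma Phi1_eq:
  assumes "\<omega> > 0"
  shows "Phi1 \<omega> x = complex_of_real (1 / sqrt (2 * pi) * (tanh (sqrt \<omega> * x))\<^sup>2)"
  using assms unfolding Phi1_def Psi1_def
  by (simp add: power_mult_distrib flip: of_real_power)

lemma Phi2_eq:
  assumes "\<omega> > 0"
  shows "Phi2 \<omega> x = complex_of_real (- (1 / sqrt (2 * pi) * (sech (sqrt \<omega> * x))\<^sup>2))"
  using assms unfolding Phi2_def Psi2_def
  by (simp add: power_mult_distrib flip: of_real_power)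

definition Q1 :: "real \<Rightarrow> real \<Rightarrow> complex \<times> complex" where
  "Q1 \<omega> x =
     (- complex_of_real (phi \<omega> x) * ((Phi1 \<omega> x)\<^sup>2 + 2 * Phi1 \<omega> x * Phi2 \<omega> x),
      complex_of_real (phi \<omega> x) * ((Phi2 \<omega> x)\<^sup>2 + 2 * Phi1 \<omega> x * Phi2 \<omega> x))"

definition distFT_plus :: "real \<Rightarrow> (real \<Rightarrow> complex \<times> complex) \<Rightarrow> real \<Rightarrow> complex" where
  "distFT_plus \<omega> F \<xi> =
     (LINT x|lborel. fst (F x) * cnj (Psi1 \<omega> x \<xi>) - snd (F x) * cnj (Psi2 \<omega> x \<xi>))"

definition Q1_tilde :: "real \<Rightarrow> real \<Rightarrow> complex" where
  "Q1_tilde \<omega> = distFT_plus \<omega> (Q1 \<omega>)"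

text \<open>
  The Bochner integral of a non-integrable function is 0 by convention. The remaining lemmas show
  that this convention plays no role in the value of \<^const>\<open>Q1_tilde\<close>.
\<close>

lemma integrable_sech:
  assumes "s > 0"
  shows "integrable lborel (\<lambda>x. sech (s * x))"
proof -
  define g :: "real \<Rightarrow> real" where "g = (\<lambda>x. indicator {0..} x * exp (- s * x))"
  have [measurable]: "g \<in> borel_measurable borel"
    unfolding g_def by measurable
  have "set_integrable lebesgue {0..} (\<lambda>x. exp (- s * x))"
    by (intro nonnegative_absolutely_integrable_1 integrable_on_exp_minus_to_infinity assms) auto
  then have "integrable lebesgue g"
    by (simp add: g_def set_integrable_def)
  then have g: "integrable lborel g"
    by (subst (asm) integrable_completion) auto
  have g': "integrable lborel (\<lambda>x. g (- x))"
    using lborel_integrable_real_affine[OF g, of "-1" 0] by simp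
  have bound: "sech (s * x) \<le> 2 * (g x + g (- x))" for x
  proof -
    have *: "sech y \<le> 2 * exp (- y)" for y
    proof -
      have "exp y \<le> 2 * cosh y" by (simp add: cosh_def)
      then have "1 \<le> 2 * exp (- y) * cosh y"
        by (simp add: exp_minus field_simps)
      then show ?thesis by (simp add: sech_def divide_le_eq)
    qed
    have "sech (s * x) \<le> 2 * exp (- s * x)" "sech (s * x) \<le> 2 * exp (s * x)"
      using *[of "s * x"] *[of "- (s * x)"] by (simp_all add: sech_def)
    then show ?thesis
      by (cases "x \<ge> 0") (auto simp: g_def indicator_def)
  qed
  show ?thesis
  proof (rule Bochner_Integration.integrable_bound)
    show "integrable lborel (\<lambda>x. 2 * (g x + g (- x)))"
      using g g' by auto
    show "(\<lambda>x. sech (s * x)) \<in> borel_measurable lborel"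
      unfolding sech_def measurable_lborel2
      by (intro borel_measurable_continuous_onI continuous_intros) auto
    show "AE x in lborel. norm (sech (s * x)) \<le> norm (2 * (g x + g (- x)))"
      using bound by (intro AE_I2) (auto simp: sech_def g_def)
  qed
qed

lemma norm_Psi_le:
  assumes "\<omega> > 0"
  defines "M \<equiv> \<lambda>\<xi>. (\<bar>\<xi>\<bar> + sqrt \<omega>)\<^sup>2
               / (norm (complex_of_real \<bar>\<xi>\<bar> - \<i> * complex_of_real (sqrt \<omega>)))\<^sup>2"
  shows "norm (Psi1 \<omega> x \<xi>) \<le> M \<xi>" and "norm (Psi2 \<omega> x \<xi>) \<le> M \<xi>"
proof -
  let ?d = "norm (complex_of_real \<bar>\<xi>\<bar> - \<i> * complex_of_real (sqrt \<omega>))"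
  have c: "1 / sqrt (2 * pi) \<le> 1"
    using pi_gt3 by (simp add: real_le_rsqrt)
  have e: "norm (exp (\<i> * complex_of_real (x * \<xi>))) = 1"
    by (rule norm_exp_i_times)
  have t: "\<bar>tanh (sqrt \<omega> * x)\<bar> \<le> 1"
    using tanh_real_bounds[of "sqrt \<omega> * x"] by auto
  have h: "0 \<le> sech (sqrt \<omega> * x)" "sech (sqrt \<omega> * x) \<le> 1"
    using cosh_real_ge_1[of "sqrt \<omega> * x"] by (auto simp: sech_def divide_le_eq)
  have *: "1 / sqrt (2 * pi) * (a\<^sup>2 / ?d\<^sup>2) \<le> M \<xi>" if "0 \<le> a" "a \<le> \<bar>\<xi>\<bar> + sqrt \<omega>" for a
  proof -
    have "a\<^sup>2 / ?d\<^sup>2 \<le> M \<xi>"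
      unfolding M_def using that by (intro divide_right_mono power_mono) auto
    moreover have "1 / sqrt (2 * pi) * (a\<^sup>2 / ?d\<^sup>2) \<le> 1 * (a\<^sup>2 / ?d\<^sup>2)"
      using c by (intro mult_right_mono) auto
    ultimately show ?thesis by simp
  qed
  have "norm (complex_of_real \<xi> + \<i> * complex_of_real (sqrt \<omega> * tanh (sqrt \<omega> * x)))
          \<le> \<bar>\<xi>\<bar> + sqrt \<omega> * \<bar>tanh (sqrt \<omega> * x)\<bar>"
    using assms(1) by (intro order_trans[OF norm_triangle_ineq]) (simp add: norm_mult abs_mult)
  also have "\<dots> \<le> \<bar>\<xi>\<bar> + sqrt \<omega>"
    using assms(1) t by (simp add: mult_left_le)
  finally have "1 / sqrt (2 * pi)
      * ((norm (complex_of_real \<xi> + \<i> * complex_of_real (sqrt \<omega> * tanh (sqrt \<omega> * x))))\<^sup>2 / ?d\<^sup>2) \<le> M \<xi>"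
    by (intro *) auto
  then show "norm (Psi1 \<omega> x \<xi>) \<le> M \<xi>"
    unfolding Psi1_def norm_mult e norm_divide norm_power by simp
  have "sqrt \<omega> * sech (sqrt \<omega> * x) \<le> \<bar>\<xi>\<bar> + sqrt \<omega>"
    using assms(1) h by (intro order_trans[OF mult_left_le[of "sech (sqrt \<omega> * x)"]]) auto
  then have "1 / sqrt (2 * pi) * ((norm (complex_of_real (sqrt \<omega> * sech (sqrt \<omega> * x))))\<^sup>2 / ?d\<^sup>2) \<le> M \<xi>"
    using assms(1) h by (intro *) (auto simp: norm_mult)
  then show "norm (Psi2 \<omega> x \<xi>) \<le> M \<xi>"
    unfolding Psi2_def norm_mult[of _ "exp _"] norm_mult[of _ "_ / _"] e norm_divide norm_power by simp
qed

lemma continuous_on_sech [continuous_intros]: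
  "continuous_on A f \<Longrightarrow> continuous_on A (\<lambda>x. sech (f x))"
  unfolding sech_def by (intro continuous_intros) auto

lemma Q1_tilde_integrable:
  assumes "\<omega> > 0"
  shows "integrable lborel
           (\<lambda>x. fst (Q1 \<omega> x) * cnj (Psi1 \<omega> x \<xi>) - snd (Q1 \<omega> x) * cnj (Psi2 \<omega> x \<xi>))"
    (is "integrable lborel ?f")
proof -
  define M where "M = (\<bar>\<xi>\<bar> + sqrt \<omega>)\<^sup>2
               / (norm (complex_of_real \<bar>\<xi>\<bar> - \<i> * complex_of_real (sqrt \<omega>)))\<^sup>2"
  have [simp]: "M \<ge> 0" by (simp add: M_def)
  have dnz: "complex_of_real r - \<i> * complex_of_real (sqrt \<omega>) \<noteq> 0" for r
    using assms by (simp add: complex_eq_iff)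
  have contPsi1: "continuous_on UNIV (\<lambda>x. Psi1 \<omega> x \<eta>)" for \<eta>
    unfolding Psi1_def using dnz by (intro continuous_intros) auto
  have contPsi2: "continuous_on UNIV (\<lambda>x. Psi2 \<omega> x \<eta>)" for \<eta>
    unfolding Psi2_def using dnz by (intro continuous_intros) auto
  have cont: "continuous_on UNIV ?f"
    unfolding Q1_def Phi1_def Phi2_def phi_def fst_conv snd_conv
    by (intro continuous_intros contPsi1 contPsi2)
  have P: "norm (Phi1 \<omega> x) \<le> 1" "norm (Phi2 \<omega> x) \<le> 1" for x
    using norm_Psi_le[OF assms, of x 0] assms
    by (simp_all add: Phi1_def Phi2_def norm_mult)
  have phi0: "phi \<omega> x \<ge> 0" for x
    using assms by (simp add: phi_def sech_def)
  have sum: "norm (a\<^sup>2 + 2 * b * c) \<le> 3" if "norm a \<le> 1" "norm b \<le> 1" "norm c \<le> 1" for a b c :: complex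
  proof -
    have "norm (a\<^sup>2 + 2 * b * c) \<le> (norm a)\<^sup>2 + 2 * (norm b * norm c)"
      by (rule order_trans[OF norm_triangle_ineq]) (simp add: norm_mult norm_power)
    also have "\<dots> \<le> 1 + 2 * 1"
      using that by (intro add_mono mult_left_mono mult_le_one power_le_one) auto
    finally show ?thesis by simp
  qed
  have f1: "norm (fst (Q1 \<omega> x)) \<le> 3 * phi \<omega> x" and f2: "norm (snd (Q1 \<omega> x)) \<le> 3 * phi \<omega> x" for x
    using mult_right_mono[OF sum[OF P(1,1,2), of x x x] phi0[of x]]
      mult_right_mono[OF sum[OF P(2,1,2), of x x x] phi0[of x]] phi0[of x]
    by (simp_all add: Q1_def norm_mult mult.commute)
  have bound: "norm (?f x) \<le> 6 * M * phi \<omega> x" for x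
  proof -
    have "norm (?f x) \<le> norm (fst (Q1 \<omega> x)) * norm (Psi1 \<omega> x \<xi>) + norm (snd (Q1 \<omega> x)) * norm (Psi2 \<omega> x \<xi>)"
      by (rule order_trans[OF norm_triangle_ineq4]) (simp add: norm_mult)
    also have "\<dots> \<le> 3 * phi \<omega> x * M + 3 * phi \<omega> x * M"
      using f1 f2 norm_Psi_le[OF assms, of x \<xi>] phi0
      by (intro add_mono mult_mono) (auto simp: M_def)
    finally show ?thesis by (simp add: mult_ac)
  qed
  show ?thesis
  proof (rule Bochner_Integration.integrable_bound)
    show "integrable lborel (\<lambda>x. 6 * M * phi \<omega> x)"
      unfolding phi_def using integrable_sech[of "sqrt \<omega>"] assms by auto
    show "?f \<in> borel_measurable lborel"
      using cont by (simp add: borel_measurable_continuous_onI)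
    show "AE x in lborel. norm (?f x) \<le> norm (6 * M * phi \<omega> x)"
      by (intro AE_I2 order_trans[OF bound]) simp
  qed
qed

end

theory Submission
  imports Defs "HOL-Complex_Analysis.Residue_Theorem"
begin

text \<open>
  After rescaling \<open>y = \<surd>\<omega> x\<close>, \<open>k = \<xi> / \<surd>\<omega>\<close>, and eliminating \<open>tanh\<^sup>2 = 1 - sech\<^sup>2\<close>, the integrand
  is \<open>e\<^bsup>-iky\<^esup>\<close> times a combination of \<open>sech\<^sup>n\<close> and \<open>tanh sech\<^sup>n\<close> with \<open>n\<close> odd. Integration by parts
  reduces their Fourier integrals to that of \<open>sech\<close>: the integral of \<open>tanh sech\<^sup>n\<close> is \<open>-ik/n\<close> times that
  of \<open>sech\<^sup>n\<close>, and \<open>(sech\<^sup>n)'' = n\<^sup>2 sech\<^sup>n - n (n + 1) sech\<^bsup>n+2\<^esup>\<close> turns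
  into a two-step recurrence in \<open>n\<close>. The transform of \<open>sech\<close> itself is
  \<open>\<pi> sech (\<pi> k / 2)\<close>, by the residue at \<open>i\<pi>/2\<close> on rectangles of height \<open>\<pi>\<close>, since the integrand is
  multiplied by \<open>-e\<^bsup>\<pi>k\<^esup>\<close> under the shift by \<open>i\<pi>\<close>.
\<close>

section \<open>Elementary calculus of sech\<close>

lemma sech_bounds: "0 < sech x" "sech x \<le> 1"
  using cosh_real_ge_1[of x] by (auto simp: sech_def divide_le_eq)

lemma sech_power_bounds:
  assumes "1 \<le> n"
  shows "0 \<le> sech x ^ n" "sech x ^ n \<le> sech x"
  using sech_bounds[of x] power_decreasing[of 1 n "sech x"] assms by auto

lemma tanh_square_sech: "(tanh x)\<^sup>2 = 1 - (sech x)\<^sup>2" for x :: real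
proof -
  have "(cosh x)\<^sup>2 \<noteq> 0" by simp
  then show ?thesis
    using cosh_square_eq[of x] by (simp add: tanh_def sech_def field_simps)
qed

lemma has_real_derivative_sech [derivative_intros]:
  assumes "(f has_real_derivative d) (at x within A)"
  shows "((\<lambda>x. sech (f x)) has_real_derivative - (sech (f x) * tanh (f x)) * d) (at x within A)"
  unfolding sech_def
  by (rule derivative_eq_intros assms refl | simp add: tanh_def power2_eq_square)+

lemma has_real_derivative_sech_power:
  assumes "1 \<le> n"
  shows "((\<lambda>x. sech x ^ n) has_real_derivative - real n * (tanh x * sech x ^ n)) (at x)"
proof -
  \<comment> \<open>The power rule produces the truncated exponent n - 1; writing n as
    \<open>Suc m\<close> turns it into m.\<close>
  obtain m where n: "n = Suc m"
    using assms by (cases n) auto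
  have "(sech has_real_derivative - (sech x * tanh x)) (at x)"
    using has_real_derivative_sech[OF DERIV_ident, of x UNIV] by simp
  from DERIV_power[OF this, of n] show ?thesis
    by (rule DERIV_cong) (simp add: n algebra_simps)
qed

lemma tendsto_sech_0: "(sech \<longlongrightarrow> 0) at_top" "(sech \<longlongrightarrow> 0) at_bot"
  unfolding sech_def
  by (intro tendsto_divide_0[OF tendsto_const] filterlim_at_top_imp_at_infinity
      cosh_real_at_top cosh_real_at_bot)+

text \<open>Domination by a multiple of sech is the integrability criterion behind all the Fourier
  integrals below; continuity supplies measurability.\<close>

lemma integrable_sech_bound:
  fixes g :: "real \<Rightarrow> complex"
  assumes "continuous_on UNIV g" "\<And>x. norm (g x) \<le> C * sech x"
  shows "integrable lborel g"
proof (rule Bochner_Integration.integrable_bound)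
  show "integrable lborel (\<lambda>x. C * sech x)"
    using integrable_sech[of 1] by simp
  show "g \<in> borel_measurable lborel"
    using assms(1) by (simp add: borel_measurable_continuous_onI)
  show "AE x in lborel. norm (g x) \<le> norm (C * sech x)"
    by (intro AE_I2 order_trans[OF assms(2)]) simp
qed

text \<open>Fundamental theorem of calculus on the whole line: sech decays at both ends, so G tends
  to 0 there, while the bound on g gives integrability. Integration by parts enters in this
  boundary-free form.\<close>

lemma integral_derivative_eq_0:
  fixes G g :: "real \<Rightarrow> complex"
  assumes deriv: "\<And>x. (G has_vector_derivative g x) (at x)"
    and cont: "continuous_on UNIV g"
    and G: "\<And>x. norm (G x) \<le> C * sech x"
    and g: "\<And>x. norm (g x) \<le> D * sech x"
  shows "(LINT x|lborel. g x) = 0"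
proof -
  have lim: "(G \<longlongrightarrow> 0) F" if "(sech \<longlongrightarrow> 0) F" for F
    by (rule Lim_null_comparison[OF _ tendsto_mult_right_zero[OF that, of C]]) (use G in auto)
  have "(LBINT x=-\<infinity>..\<infinity>. g x) = 0 - 0"
  proof (rule interval_integral_FTC_integrable[where F = G])
    show "set_integrable lborel (einterval (-\<infinity>) \<infinity>) g"
      using integrable_sech_bound[OF cont g] by (simp add: set_integrable_def)
  qed (use deriv cont lim tendsto_sech_0 in
       \<open>auto simp: continuous_on_eq_continuous_at ereal_tendsto_simps1\<close>)
  then show ?thesis
    by (simp add: interval_lebesgue_integral_def set_lebesgue_integral_def)
qed

section \<open>Fourier integrals of functions dominated by sech\<close>

text \<open>Unnormalised Fourier transform: the factor 1/sqrt(2 pi) stays with \<open>Psi1\<close>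
  and \<open>Psi2\<close>.\<close>

definition FT :: "(real \<Rightarrow> real) \<Rightarrow> real \<Rightarrow> complex" where
  "FT f k = (LINT x|lborel. complex_of_real (f x) * exp (- (\<i> * of_real (k * x))))"

lemma norm_exp_minus_i: "norm (exp (- (\<i> * complex_of_real r))) = 1"
  by (simp add: norm_exp_eq_Re)

lemma integrable_FT:
  assumes "continuous_on UNIV f" "\<And>x. \<bar>f x\<bar> \<le> C * sech x"
  shows "integrable lborel (\<lambda>x. complex_of_real (f x) * exp (- (\<i> * of_real (k * x))))"
  by (rule integrable_sech_bound)
     (use assms in \<open>auto simp: norm_mult norm_exp_minus_i simp del: of_real_mult
        intro!: continuous_intros\<close>)

text \<open>The product f(x) exp(-ikx) has derivative (f'(x) - ik f(x)) exp(-ikx), whose integral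
  over the line vanishes. Both terms are integrable, so the integral splits.\<close>

lemma FT_derivative:
  assumes deriv: "\<And>x. (f has_real_derivative f' x) (at x)"
    and cont: "continuous_on UNIV f'"
    and f: "\<And>x. \<bar>f x\<bar> \<le> C * sech x"
    and f': "\<And>x. \<bar>f' x\<bar> \<le> D * sech x"
  shows "FT f' k = \<i> * of_real k * FT f k"
proof -
  let ?e = "\<lambda>x. exp (- (\<i> * complex_of_real (k * x)))"
  let ?g = "\<lambda>x. of_real (f' x) * ?e x - \<i> * of_real k * (of_real (f x) * ?e x)"
  have contf: "continuous_on UNIV f"
    using DERIV_isCont[OF deriv] by (simp add: continuous_at_imp_continuous_on)
  have "(LINT x|lborel. ?g x) = 0"
  proof (rule integral_derivative_eq_0[where G = "\<lambda>x. of_real (f x) * ?e x" and C = C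
        and D = "D + \<bar>k\<bar> * C"])
    fix x
    have e: "(?e has_vector_derivative - (\<i> * of_real k) * ?e x) (at x)"
      by (rule has_vector_derivative_real_field derivative_eq_intros refl | simp)+
    show "((\<lambda>x. of_real (f x) * ?e x) has_vector_derivative ?g x) (at x)"
      by (rule has_vector_derivative_eq_rhs[OF has_vector_derivative_mult[OF
            has_vector_derivative_of_real[OF deriv] e]]) simp
    show "norm (of_real (f x) * ?e x) \<le> C * sech x"
      using f by (simp add: norm_mult norm_exp_minus_i del: of_real_mult)
    have "norm (?g x) \<le> \<bar>f' x\<bar> + \<bar>k\<bar> * \<bar>f x\<bar>"
      by (rule order_trans[OF norm_triangle_ineq4])
         (simp add: norm_mult norm_exp_minus_i del: of_real_mult)
    also have "\<dots> \<le> D * sech x + \<bar>k\<bar> * (C * sech x)"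
      using f f' by (intro add_mono mult_left_mono) auto
    finally show "norm (?g x) \<le> (D + \<bar>k\<bar> * C) * sech x"
      by (simp add: algebra_simps)
  qed (intro continuous_intros cont contf)
  then show ?thesis
    using integrable_FT[OF cont f', of k] integrable_FT[OF contf f, of k]
    by (simp add: FT_def)
qed

section \<open>Powers of sech, with and without a factor tanh\<close>

lemma abs_tanh_sech_power_le:
  assumes "1 \<le> n"
  shows "\<bar>tanh x * sech x ^ n\<bar> \<le> sech x"
proof -
  have "\<bar>tanh x\<bar> \<le> 1" using tanh_real_bounds[of x] by auto
  then show ?thesis
    using sech_power_bounds[OF assms, of x] unfolding abs_mult
    by (auto intro: order_trans[OF mult_left_le_one_le])
qed

lemma integrable_FT_sech:
  assumes "1 \<le> n"
  shows "integrable lborel (\<lambda>x. complex_of_real (sech x ^ n) * exp (- (\<i> * of_real (k * x))))"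
    and "integrable lborel
      (\<lambda>x. complex_of_real (tanh x * sech x ^ n) * exp (- (\<i> * of_real (k * x))))"
proof -
  show "integrable lborel (\<lambda>x. complex_of_real (sech x ^ n) * exp (- (\<i> * of_real (k * x))))"
    using sech_power_bounds[OF assms]
    by (intro integrable_FT[where C = 1] continuous_intros) simp
  show "integrable lborel
      (\<lambda>x. complex_of_real (tanh x * sech x ^ n) * exp (- (\<i> * of_real (k * x))))"
    using abs_tanh_sech_power_le[OF assms]
    by (intro integrable_FT[where C = 1] continuous_intros) auto
qed

text \<open>Since (sech^n)' = -n tanh sech^n, this is the derivative rule applied to sech^n.\<close>

lemma FT_tanh_sech_power:
  assumes "1 \<le> n"
  shows "FT (\<lambda>x. tanh x * sech x ^ n) k = - \<i> * of_real k / of_nat n * FT (\<lambda>x. sech x ^ n) k"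
proof -
  have "FT (\<lambda>x. - real n * (tanh x * sech x ^ n)) k = \<i> * of_real k * FT (\<lambda>x. sech x ^ n) k"
  proof (rule FT_derivative[where C = 1 and D = "real n"])
    show "((\<lambda>x. sech x ^ n) has_real_derivative - real n * (tanh x * sech x ^ n)) (at x)" for x
      by (rule has_real_derivative_sech_power[OF assms])
    show "\<bar>sech x ^ n\<bar> \<le> 1 * sech x" for x
      using sech_power_bounds[OF assms, of x] by simp
    show "\<bar>- real n * (tanh x * sech x ^ n)\<bar> \<le> real n * sech x" for x
      using mult_left_mono[OF abs_tanh_sech_power_le[OF assms, of x], of "real n"]
      by (simp add: abs_mult)
  qed (intro continuous_intros; simp)
  moreover have "FT (\<lambda>x. - real n * (tanh x * sech x ^ n)) k
      = - of_nat n * FT (\<lambda>x. tanh x * sech x ^ n) k"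
    by (simp add: FT_def mult.assoc)
  ultimately show ?thesis
    using assms by (simp add: field_simps)
qed

text \<open>By tanh^2 = 1 - sech^2, the derivative of tanh sech^n is (n + 1) sech^(n+2) - n sech^n.
  The derivative rule turns this into a relation between the transforms of sech^(n+2), sech^n and
  tanh sech^n, and the last of these is already known.\<close>

lemma FT_sech_power_add2:
  assumes "1 \<le> n"
  shows "FT (\<lambda>x. sech x ^ (n + 2)) k
    = of_real (((real n)\<^sup>2 + k\<^sup>2) / (real n * (real n + 1))) * FT (\<lambda>x. sech x ^ n) k"
proof -
  let ?f' = "\<lambda>x. real (n + 1) * sech x ^ (n + 2) - real n * sech x ^ n"
  have "FT ?f' k = \<i> * of_real k * FT (\<lambda>x. tanh x * sech x ^ n) k"
  proof (rule FT_derivative[where C = 1 and D = "2 * real n + 1"])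
    fix x
    have "((\<lambda>x. tanh x * sech x ^ n) has_real_derivative
        (1 - (tanh x)\<^sup>2) * sech x ^ n - real n * (tanh x)\<^sup>2 * sech x ^ n) (at x)"
      by (rule derivative_eq_intros has_real_derivative_sech_power[OF assms] refl
          | simp add: power2_eq_square algebra_simps)+
    then show "((\<lambda>x. tanh x * sech x ^ n) has_real_derivative ?f' x) (at x)"
      unfolding tanh_square_sech by (simp add: algebra_simps power2_eq_square)
    show "\<bar>tanh x * sech x ^ n\<bar> \<le> 1 * sech x"
      using abs_tanh_sech_power_le[OF assms, of x] by simp
    have "\<bar>?f' x\<bar> \<le> real (n + 1) * sech x ^ (n + 2) + real n * sech x ^ n"
      using sech_bounds(1)[of x]
      by (intro order_trans[OF abs_triangle_ineq4]) (simp add: abs_mult)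
    also have "\<dots> \<le> real (n + 1) * sech x + real n * sech x"
      using assms by (intro add_mono mult_left_mono sech_power_bounds) auto
    finally show "\<bar>?f' x\<bar> \<le> (2 * real n + 1) * sech x"
      by (simp add: algebra_simps)
  qed (intro continuous_intros)
  moreover have "FT ?f' k = of_real (real n + 1) * FT (\<lambda>x. sech x ^ (n + 2)) k
      - of_nat n * FT (\<lambda>x. sech x ^ n) k"
  proof -
    have "complex_of_real (?f' x) * e = of_real (real n + 1) * (of_real (sech x ^ (n + 2)) * e)
      - of_nat n * (of_real (sech x ^ n) * e)" for x e
      by (simp add: algebra_simps)
    then show ?thesis
      unfolding FT_def
      using integrable_FT_sech(1)[OF assms, of k] integrable_FT_sech(1)[of "n + 2" k]
      by (simp only: Bochner_Integration.integral_diff integrable_mult_right integral_mult_right_zero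
          le_add2 numeral_le_iff)
  qed
  \<comment> \<open>The term k^2/n is the product of ik, from the derivative rule, and -ik/n, from
    the transform of tanh sech^n.\<close>
  ultimately have "of_real (real n + 1) * FT (\<lambda>x. sech x ^ (n + 2)) k
      = of_real (real n + k\<^sup>2 / real n) * FT (\<lambda>x. sech x ^ n) k"
    unfolding FT_tanh_sech_power[OF assms] by (simp add: algebra_simps power2_eq_square)
  then have "FT (\<lambda>x. sech x ^ (n + 2)) k
      = of_real (real n + k\<^sup>2 / real n) * FT (\<lambda>x. sech x ^ n) k / of_real (real n + 1)"
    by (metis nonzero_mult_div_cancel_left of_real_eq_0_iff of_nat_Suc of_nat_neq_0 add.commute)
  also have "\<dots> = of_real ((real n + k\<^sup>2 / real n) / (real n + 1)) * FT (\<lambda>x. sech x ^ n) k"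
    by simp
  also have "(real n + k\<^sup>2 / real n) / (real n + 1) = ((real n)\<^sup>2 + k\<^sup>2) / (real n * (real n + 1))"
    using assms by (simp add: divide_simps power2_eq_square)
  finally show ?thesis .
qed

section \<open>The Fourier transform of sech\<close>

text \<open>The zeros of cosh are i(pi/2 + n pi) for integer n. The neighbours -i pi/2 and 3i pi/2
  lie on the boundary of the open strip and are thus excluded.\<close>

lemma cosh_eq_0_strip:
  assumes "cosh z = 0" "- (pi / 2) < Im z" "Im z < pi + pi / 2"
  shows "z = \<i> * of_real (pi / 2)"
proof -
  \<comment> \<open>A zero of cosh satisfies exp(2z) = -1; writing -1 as exp(i pi) makes the
    periodicity of exp applicable.\<close>
  have "exp (2 * z) = exp (\<i> * of_real pi)"
    using assms(1) by (simp add: cosh_zero_iff exp_double)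
  then obtain n :: int where n: "2 * z = \<i> * of_real pi + of_int (2 * n) * of_real pi * \<i>"
    unfolding exp_eq by auto
  then have im: "2 * Im z = pi + 2 * real_of_int n * pi" and re: "Re z = 0"
    by (auto simp: complex_eq_iff)
  have "- 1 * pi < real_of_int n * pi" "real_of_int n * pi < 1 * pi"
    using im assms(2,3) by linarith+
  then have "n = 0"
    unfolding mult_less_cancel_right_pos[OF pi_gt_zero] by linarith
  then show ?thesis
    using im re by (simp add: complex_eq_iff)
qed

text \<open>Reverse triangle inequality for exp z and exp(-z), whose moduli are exp(Re z) and
  exp(-Re z). It makes the integrand small on the vertical sides of the rectangle.\<close>

lemma norm_cosh_ge: "\<bar>sinh (Re z)\<bar> \<le> norm (cosh z)" for z :: complex
proof -
  have "\<bar>exp (Re z) - exp (- Re z)\<bar> \<le> norm (exp z + exp (- z))"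
    using norm_triangle_ineq3[of "exp z" "- exp (- z)"] by (simp add: norm_exp_eq_Re)
  then show ?thesis
    by (simp add: cosh_def sinh_def norm_divide)
qed

text \<open>Addition formula with cosh(i pi) = -1 and sinh(i pi) = 0.\<close>

lemma cosh_plus_i_pi: "cosh (z + \<i> * of_real pi) = - cosh z"
  by (simp add: cosh_add cosh_def[of "\<i> * of_real pi"] sinh_def[of "\<i> * of_real pi"]
      exp_minus exp_Euler scaleR_conv_of_real)

text \<open>Serves to move the top side of the rectangle down to the real axis.\<close>

lemma contour_integral_translate_linepath:
  "contour_integral (linepath (a + c) (b + c)) f = contour_integral (linepath a b) (\<lambda>z. f (z + c))"
proof -
  have "linepath (a + c) (b + c) x = linepath a b x + c" for x
    by (simp add: linepath_def algebra_simps)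
  then show ?thesis
    by (simp add: contour_integral_integral)
qed

text \<open>At a simple pole the residue is the numerator divided by the derivative of the
  denominator, here sinh(i pi/2) = i. The numerator there is exp(k pi/2).\<close>

lemma residue_exp_over_cosh:
  "residue (\<lambda>z. exp (- (\<i> * of_real k * z)) / cosh z) (\<i> * of_real (pi / 2))
    = - \<i> * of_real (exp (k * pi / 2))"
proof -
  let ?p = "\<i> * complex_of_real (pi / 2)"
  have s: "sinh ?p = \<i>" "cosh ?p = 0"
    by (simp_all add: sinh_conv_sin cosh_conv_cos cos_of_real sin_of_real)
  have "residue (\<lambda>z. exp (- (\<i> * of_real k * z)) / cosh z) ?p = exp (- (\<i> * of_real k * ?p)) / sinh ?p"
    by (rule residue_simple_pole_deriv[where s = UNIV])
       (use s in \<open>auto intro!: derivative_eq_intros holomorphic_intros analytic_imp_holomorphic analytic_intros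
          simp del: of_real_divide\<close>)
  also have "\<dots> = - \<i> * of_real (exp (k * pi / 2))"
  proof -
    have "- (\<i> * of_real k * ?p) = complex_of_real (k * pi / 2)"
      by (simp add: complex_eq_iff)
    then show ?thesis
      unfolding s exp_of_real[symmetric] by (simp add: divide_complex_def del: of_real_divide of_real_mult)
  qed
  finally show ?thesis .
qed

text \<open>Residue theorem on the rectangle with corners -R, R, R + i pi, -R + i pi. Bottom and top
  together give 1 + exp(k pi) times the integral, the residue gives 2 pi exp(k pi/2), and the error
  consists of the two vertical sides, each of length pi.\<close>

lemma sech_integral_rectangle_bound:
  assumes "R > 0"
  shows "norm ((1 + exp (complex_of_real (k * pi)))
      * integral {-R..R} (\<lambda>x. exp (- (\<i> * of_real (k * x))) / cosh (complex_of_real x))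
      - 2 * pi * exp (complex_of_real (k * pi / 2))) \<le> 2 * pi * exp (\<bar>k\<bar> * pi) / sinh R"
proof -
  define f where "f = (\<lambda>z. exp (- (\<i> * of_real k * z)) / cosh z)"
  \<comment> \<open>An open strip containing the closed rectangle and only one zero of cosh.\<close>
  define S where "S = {z. - (pi / 2) < Im z} \<inter> {z. Im z < pi + pi / 2}"
  let ?p = "\<i> * complex_of_real (pi / 2)"
  let ?a = "- complex_of_real R" and ?b = "complex_of_real R" and ?c = "\<i> * complex_of_real pi"
  let ?rect = "rectpath ?a (?b + ?c)"
  have rect: "?rect = linepath ?a ?b +++ linepath ?b (?b + ?c) +++ linepath (?b + ?c) (?a + ?c)
      +++ linepath (?a + ?c) ?a"
    by (simp add: rectpath_def Let_def complex_eq_iff Complex_eq)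
  have S: "open S" "connected S"
    unfolding S_def
    by (intro open_Int open_halfspace_Im_gt open_halfspace_Im_lt convex_connected
        convex_Int convex_halfspace_Im_gt convex_halfspace_Im_lt)+
  have cosh_nz: "cosh z \<noteq> 0" if "z \<in> S - {?p}" for z
    using cosh_eq_0_strip[of z] that by (auto simp: S_def)
  have holo: "f holomorphic_on S - {?p}"
    unfolding f_def using cosh_nz
    by (intro analytic_imp_holomorphic analytic_intros) auto
  have cbox: "cbox ?a (?b + ?c) \<subseteq> S"
  proof
    fix z assume "z \<in> cbox ?a (?b + ?c)"
    then have "0 \<le> Im z" "Im z \<le> pi"
      by (simp_all add: in_cbox_complex_iff)
    then show "z \<in> S"
      using pi_gt_zero unfolding S_def Int_iff mem_Collect_eq by (intro conjI) linarith+
  qed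
  have img: "path_image ?rect \<subseteq> S - {?p}"
    using cbox assms path_image_rectpath_cbox_minus_box[of ?a "?b + ?c"]
    by (auto simp: in_box_complex_iff)
  have "contour_integral ?rect f = 2 * pi * \<i> * (\<Sum>p\<in>{?p}. winding_number ?rect p * residue f p)"
  proof (rule Residue_theorem[OF S _ holo _ _ img])
    show "\<forall>z. z \<notin> S \<longrightarrow> winding_number ?rect z = 0"
      using cbox assms by (auto intro!: winding_number_rectpath_outside)
  qed auto
  moreover have "winding_number ?rect ?p = 1"
    using assms by (intro winding_number_rectpath) (auto simp: in_box_complex_iff)
  ultimately have total: "contour_integral ?rect f = 2 * pi * exp (complex_of_real (k * pi / 2))"
    using residue_exp_over_cosh[of k]
    by (simp add: f_def exp_of_real mult.assoc del: of_real_mult of_real_divide)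

  have cont: "continuous_on (closed_segment u v) f" if "closed_segment u v \<subseteq> path_image ?rect" for u v
    using order_trans[OF that img]
    by (rule continuous_on_subset[OF holomorphic_on_imp_continuous_on[OF holo]])
  have parts: "f contour_integrable_on linepath ?a ?b" "f contour_integrable_on linepath ?b (?b + ?c)"
    "f contour_integrable_on linepath (?b + ?c) (?a + ?c)" "f contour_integrable_on linepath (?a + ?c) ?a"
    by (intro contour_integrable_continuous_linepath cont; auto simp: rect path_image_join)+
  have ab: "continuous_on (closed_segment ?a ?b) f"
    by (rule cont) (simp add: rect path_image_join)
  have bottom: "contour_integral (linepath ?a ?b) f
      = integral {-R..R} (\<lambda>x. exp (- (\<i> * of_real (k * x))) / cosh (complex_of_real x))"
    using assms by (subst contour_integral_linepath_Reals_eq) (auto simp: f_def mult.assoc)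
  \<comment> \<open>The shift by i pi multiplies the numerator by exp(k pi) and changes the sign of
    cosh.\<close>
  have "f (z + ?c) = - exp (complex_of_real (k * pi)) * f z" for z
    by (simp add: f_def cosh_plus_i_pi algebra_simps exp_add[symmetric] exp_diff exp_minus field_simps)
  then have "contour_integral (linepath (?b + ?c) (?a + ?c)) f
      = contour_integral (linepath ?b ?a) (\<lambda>z. - exp (complex_of_real (k * pi)) * f z)"
    by (simp only: contour_integral_translate_linepath)
  also have "\<dots> = - exp (complex_of_real (k * pi)) * contour_integral (linepath ?b ?a) f"
    using ab by (intro contour_integral_lmul contour_integrable_continuous_linepath)
      (simp only: closed_segment_commute)
  \<comment> \<open>The top side runs from right to left, and this reversal cancels the minus
    sign.\<close>
  also have "\<dots> = exp (complex_of_real (k * pi)) * contour_integral (linepath ?a ?b) f"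
    unfolding contour_integral_reverse_linepath[OF ab] by simp
  finally have top: "contour_integral (linepath (?b + ?c) (?a + ?c)) f
      = exp (complex_of_real (k * pi)) * contour_integral (linepath ?a ?b) f" .
  \<comment> \<open>Stating the endpoint heights as a set covers both the upward right side and the
    downward left side.\<close>
  have side: "norm (contour_integral (linepath u v) f) \<le> pi * exp (\<bar>k\<bar> * pi) / sinh R"
    if uv: "f contour_integrable_on linepath u v" "\<bar>Re u\<bar> = R" "Re v = Re u"
      "{Im u, Im v} = {0, pi}" for u v
  proof -
    have "norm (f z) \<le> exp (\<bar>k\<bar> * pi) / sinh R" if z: "z \<in> closed_segment u v" for z
    proof -
      have re: "\<bar>Re z\<bar> = R" and im: "0 \<le> Im z" "Im z \<le> pi"
        using z uv(2-4) pi_gt_zero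
        by (auto simp: closed_segment_same_Re closed_segment_eq_real_ivl doubleton_eq_iff not_le
            simp del: pi_gt_zero split: if_splits)
      have "sinh R \<le> norm (cosh z)"
        using norm_cosh_ge[of z] re by (auto simp: abs_if split: if_splits)
      \<comment> \<open>The numerator has modulus exp(k Im z), because Re(-ikz) = k Im z.\<close>
      moreover have "k * Im z \<le> \<bar>k\<bar> * pi"
        using im mult_mono[of k "\<bar>k\<bar>" "Im z" pi] by simp
      ultimately show ?thesis
        using assms by (auto simp: f_def norm_divide norm_exp_eq_Re intro!: frac_le)
    qed
    moreover have "norm (v - u) = pi"
      using uv(3,4) by (auto simp: cmod_def doubleton_eq_iff)
    ultimately show ?thesis
      using contour_integral_bound_linepath[OF uv(1), of "exp (\<bar>k\<bar> * pi) / sinh R"] assms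
      by (simp add: mult_ac)
  qed
  define B where "B = contour_integral (linepath ?a ?b) f"
  define V where "V = contour_integral (linepath ?b (?b + ?c)) f"
  define W where "W = contour_integral (linepath (?a + ?c) ?a) f"
  have "contour_integral ?rect f = B + (V + (exp (complex_of_real (k * pi)) * B + W))"
    unfolding rect B_def V_def W_def top[symmetric]
    using parts by (simp add: contour_integral_join contour_integrable_joinI)
  then have "(1 + exp (complex_of_real (k * pi))) * B - 2 * pi * exp (complex_of_real (k * pi / 2))
      = - V + - W"
    unfolding total by (simp add: algebra_simps)
  also have "norm \<dots> \<le> norm V + norm W"
    using norm_triangle_ineq[of "- V" "- W"] by simp
  also have "\<dots> \<le> pi * exp (\<bar>k\<bar> * pi) / sinh R + pi * exp (\<bar>k\<bar> * pi) / sinh R"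
    unfolding V_def W_def using assms by (intro add_mono side parts) auto
  finally show ?thesis
    unfolding B_def bottom by simp
qed

text \<open>Letting R tend to infinity along the integers in the rectangle estimate gives (1 + exp(k
  pi)) \<open>FT sech k\<close> = 2 pi exp(k pi/2), which is then solved for the transform.\<close>

lemma FT_sech: "FT sech k = of_real (pi * sech (pi / 2 * k))"
proof -
  define g where "g = (\<lambda>x. complex_of_real (sech x) * exp (- (\<i> * of_real (k * x))))"
  let ?I = "\<lambda>R. integral {-R..R} (\<lambda>x. exp (- (\<i> * of_real (k * x))) / cosh (complex_of_real x))"
  have int: "integrable lborel g"
    unfolding g_def using integrable_FT_sech(1)[of 1 k] by (simp only: power_one_right)
  have I_eq: "?I R = (LINT x|lborel. indicator {-R..R} x *\<^sub>R g x)" for R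
  proof -
    have "set_integrable lborel {-R..R} g"
      unfolding set_integrable_def using integrable_mult_indicator[OF _ int] by simp
    moreover have "exp (- (\<i> * of_real (k * x))) / cosh (complex_of_real x) = g x" for x
      by (simp add: g_def sech_def cosh_field_def exp_of_real[symmetric] exp_minus[symmetric] del: exp_of_real)
    ultimately show ?thesis
      using set_borel_integral_eq_integral(2)[of "{-R..R}" g]
      by (simp add: set_lebesgue_integral_def)
  qed
  have "(\<lambda>n. ?I (real n)) \<longlonglongrightarrow> (LINT x|lborel. g x)"
    unfolding I_eq
  proof (rule integral_dominated_convergence[where w = "\<lambda>x. norm (g x)"])
    show "AE x in lborel. (\<lambda>n. indicator {- real n..real n} x *\<^sub>R g x) \<longlonglongrightarrow> g x"
    proof (intro AE_I2 tendsto_eventually)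
      fix x :: real
      obtain N :: nat where N: "\<bar>x\<bar> \<le> real N"
        using real_arch_simple by blast
      show "\<forall>\<^sub>F n in sequentially. indicator {- real n..real n} x *\<^sub>R g x = g x"
        using eventually_ge_at_top[of N] by eventually_elim (use N in \<open>auto simp: indicator_def\<close>)
    qed
  qed (use int in \<open>auto simp: indicator_def\<close>)
  then have lim: "(\<lambda>n. (1 + exp (complex_of_real (k * pi))) * ?I (real n)
        - 2 * pi * exp (complex_of_real (k * pi / 2)))
      \<longlonglongrightarrow> (1 + exp (complex_of_real (k * pi))) * FT sech k - 2 * pi * exp (complex_of_real (k * pi / 2))"
    unfolding FT_def g_def by (intro tendsto_intros)
  have null: "(\<lambda>n. 2 * pi * exp (\<bar>k\<bar> * pi) / sinh (real n)) \<longlonglongrightarrow> 0"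
    by (intro tendsto_divide_0[OF tendsto_const] filterlim_at_top_imp_at_infinity
        filterlim_compose[OF sinh_real_at_top filterlim_real_sequentially])
  have "\<forall>\<^sub>F n in sequentially. norm ((1 + exp (complex_of_real (k * pi))) * ?I (real n)
        - 2 * pi * exp (complex_of_real (k * pi / 2))) \<le> 2 * pi * exp (\<bar>k\<bar> * pi) / sinh (real n)"
    \<comment> \<open>The index 0 is left out, as the rectangle must have positive width.\<close>
    using eventually_gt_at_top[of 0]
    by eventually_elim (rule sech_integral_rectangle_bound, simp)
  from Lim_null_comparison[OF this null]
  have "(1 + exp (complex_of_real (k * pi))) * FT sech k
      - 2 * pi * exp (complex_of_real (k * pi / 2)) = 0"
    by (rule LIMSEQ_unique[OF lim])
  then have "of_real (1 + exp (k * pi)) * FT sech k = of_real (2 * pi * exp (k * pi / 2))"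
    by (simp add: exp_of_real del: of_real_mult of_real_divide)
       (simp add: mult.assoc)
  moreover have "1 + exp (k * pi) \<noteq> 0"
    using exp_gt_zero[of "k * pi"] by linarith
  ultimately have "FT sech k = of_real (2 * pi * exp (k * pi / 2) / (1 + exp (k * pi)))"
    by (metis nonzero_mult_div_cancel_left of_real_divide of_real_eq_0_iff)
  also have "2 * pi * exp (k * pi / 2) / (1 + exp (k * pi)) = pi * sech (pi / 2 * k)"
  \<comment> \<open>Dividing numerator and denominator by exp(k pi/2) leaves 2 cosh(k pi/2)
    below.\<close>
  proof -
    define e where "e = exp (k * pi / 2)"
    have e: "e > 0" "exp (k * pi) = e * e" "cosh (pi / 2 * k) = (e + 1 / e) / 2"
      unfolding e_def by (simp_all add: exp_add[symmetric] cosh_def exp_minus field_simps)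
    have "1 + e * e \<noteq> 0"
      using e(1) by (simp add: add_pos_pos less_imp_neq[symmetric])
    then show ?thesis
      unfolding sech_def e(2,3) e_def[symmetric] using e(1) by (simp add: field_simps)
  qed
  finally show ?thesis .
qed

section \<open>The distorted Fourier transform of the quadratic term\<close>

text \<open>The coefficients are those of the expanded integrand. Every transform is a polynomial in
  k times that of sech, and the sum of these polynomials factors. The factor k^2 - 1 is the source
  of the zeros at \<xi> = \<plusminus> sqrt \<omega>.\<close>

lemma FT_sech_combination:
  "((of_real k)\<^sup>2 - 1) * FT (\<lambda>x. sech x ^ 1) k + (5 - 4 * (of_real k)\<^sup>2) * FT (\<lambda>x. sech x ^ 3) k
    + (3 * (of_real k)\<^sup>2 - 9) * FT (\<lambda>x. sech x ^ 5) k + 6 * FT (\<lambda>x. sech x ^ 7) k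
    - 2 * \<i> * of_real k * (FT (\<lambda>x. tanh x * sech x ^ 1) k
      - 4 * FT (\<lambda>x. tanh x * sech x ^ 3) k + 3 * FT (\<lambda>x. tanh x * sech x ^ 5) k)
  = of_real ((k\<^sup>2 - 1) * k\<^sup>2 * (k\<^sup>2 + 1) / 12 * (pi * sech (pi / 2 * k)))"
proof -
  define I where "I = FT (\<lambda>x. sech x ^ 1) k"
  \<comment> \<open>The recurrence is used at n = 1, 3, 5, with denominators n(n + 1) = 2, 12,
    30.\<close>
  have I3: "FT (\<lambda>x. sech x ^ 3) k = of_real ((1 + k\<^sup>2) / 2) * I"
    using FT_sech_power_add2[of 1 k] by (simp add: I_def numeral_eq_Suc)
  have I5: "FT (\<lambda>x. sech x ^ 5) k = of_real ((9 + k\<^sup>2) / 12 * ((1 + k\<^sup>2) / 2)) * I"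
    using FT_sech_power_add2[of 3 k] I3 by simp
  have I7: "FT (\<lambda>x. sech x ^ 7) k
      = of_real ((25 + k\<^sup>2) / 30 * ((9 + k\<^sup>2) / 12 * ((1 + k\<^sup>2) / 2))) * I"
    using FT_sech_power_add2[of 5 k] I5 by simp
  have I1: "I = of_real (pi * sech (pi / 2 * k))"
    unfolding I_def FT_sech[symmetric] by simp
  show ?thesis
    unfolding FT_tanh_sech_power[of 1, simplified] FT_tanh_sech_power[of 3, simplified]
      FT_tanh_sech_power[of 5, simplified] FT_tanh_sech_power[OF order_refl]
      I3 I5 I7 I_def[symmetric] of_real_mult[of _ "pi * sech (pi / 2 * k)"] I1[symmetric]
    by (simp add: field_simps power2_eq_square)
qed

text \<open>With S for sech and t for tanh, even powers of t are eliminated. What remains is linear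
  in t, and its odd part comes only from the cross term of (k - it)^2.\<close>

lemma Q1_polynomial_identity:
  fixes S t k :: complex
  assumes "t\<^sup>2 = 1 - S\<^sup>2"
  shows "S * (((t\<^sup>2)\<^sup>2 - 2 * t\<^sup>2 * S\<^sup>2) * (k - \<i> * t)\<^sup>2 + ((S\<^sup>2)\<^sup>2 - 2 * t\<^sup>2 * S\<^sup>2) * S\<^sup>2)
    = (k\<^sup>2 - 1) * S ^ 1 + (5 - 4 * k\<^sup>2) * S ^ 3 + (3 * k\<^sup>2 - 9) * S ^ 5 + 6 * S ^ 7
      - 2 * \<i> * k * (t * S ^ 1 - 4 * (t * S ^ 3) + 3 * (t * S ^ 5))"
proof -
  have expand: "(k - \<i> * t)\<^sup>2 = k\<^sup>2 - 2 * \<i> * k * t - (1 - S\<^sup>2)"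
    by (simp add: power2_diff power_mult_distrib assms algebra_simps)
  show ?thesis
    unfolding expand assms by (simp add: algebra_simps numeral_eq_Suc)
qed

text \<open>In the variables \<omega> = s^2, x = y/s, \<xi> = sk, \<open>phi\<close> contributes
  sqrt 2 s and the numerators of \<open>Psi1\<close> and \<open>Psi2\<close> contribute s^2. Two
  factors \<open>Phi1\<close> or \<open>Phi2\<close> and one factor \<open>Psi1\<close> or
  \<open>Psi2\<close> give the cube of 1/sqrt(2 pi). Conjugation turns |\<xi>| - is into |\<xi>| +
  is. Each summand keeps its own exponential so as to match the integrands of
  \<open>FT\<close>.\<close>

lemma Q1_tilde_integrand:
  fixes s k y :: real
  assumes "s > 0"
  defines "e \<equiv> exp (- (\<i> * complex_of_real (k * y)))"
  shows "fst (Q1 (s\<^sup>2) (y / s)) * cnj (Psi1 (s\<^sup>2) (y / s) (s * k))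
      - snd (Q1 (s\<^sup>2) (y / s)) * cnj (Psi2 (s\<^sup>2) (y / s) (s * k))
    = - of_real (sqrt 2 * s ^ 3 / (sqrt (2 * pi)) ^ 3) / (of_real \<bar>s * k\<bar> + \<i> * of_real s)\<^sup>2 *
      (((of_real k)\<^sup>2 - 1) * (of_real (sech y ^ 1) * e) + (5 - 4 * (of_real k)\<^sup>2) * (of_real (sech y ^ 3) * e)
      + (3 * (of_real k)\<^sup>2 - 9) * (of_real (sech y ^ 5) * e) + 6 * (of_real (sech y ^ 7) * e)
      - 2 * \<i> * of_real k * (of_real (tanh y * sech y ^ 1) * e
        - 4 * (of_real (tanh y * sech y ^ 3) * e) + 3 * (of_real (tanh y * sech y ^ 5) * e)))"
    (is "?lhs = - of_real ?C / ?D * ?rhs")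
proof -
  define S t K q where "S = complex_of_real (sech y)" and "t = complex_of_real (tanh y)"
    and "K = complex_of_real k" and "q = complex_of_real (sqrt (2 * pi))"
  let ?s = "complex_of_real s" and ?r = "complex_of_real (sqrt 2)"
  have "complex_of_real ((tanh y)\<^sup>2) = of_real (1 - (sech y)\<^sup>2)"
    by (simp only: tanh_square_sech)
  then have tS: "t\<^sup>2 = 1 - S\<^sup>2"
    by (simp add: t_def S_def)
  have q: "q \<noteq> 0"
    by (simp add: q_def)
  have D: "?D \<noteq> 0"
    using assms(1) by (intro power_not_zero) (simp add: complex_eq_iff)
  have phi: "complex_of_real (phi (s\<^sup>2) (y / s)) = ?r * ?s * S"
    using assms by (simp add: phi_def S_def real_sqrt_mult)
  have Phi1: "Phi1 (s\<^sup>2) (y / s) = t\<^sup>2 / q" and Phi2: "Phi2 (s\<^sup>2) (y / s) = - S\<^sup>2 / q"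
    using assms by (simp_all add: Phi1_eq Phi2_eq t_def S_def q_def)
  have ce: "cnj (exp (\<i> * complex_of_real (y / s * (s * k)))) = e"
    using assms by (simp add: e_def exp_cnj mult.commute)
  have Psi1: "cnj (Psi1 (s\<^sup>2) (y / s) (s * k)) = 1 / q * ((?s * (K - \<i> * t))\<^sup>2 / ?D) * e"
    using assms unfolding Psi1_def complex_cnj_mult ce
    by (simp add: q_def K_def t_def algebra_simps)
  have Psi2: "cnj (Psi2 (s\<^sup>2) (y / s) (s * k)) = 1 / q * ((?s * S)\<^sup>2 / ?D) * e"
    using assms unfolding Psi2_def complex_cnj_mult ce
    by (simp add: q_def S_def)
  have "?lhs = - (?r * ?s * S) * ((t\<^sup>2 / q)\<^sup>2 + 2 * (t\<^sup>2 / q) * (- S\<^sup>2 / q))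
        * (1 / q * ((?s * (K - \<i> * t))\<^sup>2 / ?D) * e)
      - (?r * ?s * S) * ((- S\<^sup>2 / q)\<^sup>2 + 2 * (t\<^sup>2 / q) * (- S\<^sup>2 / q)) * (1 / q * ((?s * S)\<^sup>2 / ?D) * e)"
    unfolding Q1_def fst_conv snd_conv Psi1 Psi2 Phi1 Phi2 phi ..
  also have "\<dots> = - (?r * ?s ^ 3 / q ^ 3) / ?D * ((S * (((t\<^sup>2)\<^sup>2 - 2 * t\<^sup>2 * S\<^sup>2) * (K - \<i> * t)\<^sup>2
      + ((S\<^sup>2)\<^sup>2 - 2 * t\<^sup>2 * S\<^sup>2) * S\<^sup>2)) * e)"
  proof -
    \<comment> \<open>Naming the denominator keeps the simplifier from expanding its square.\<close>
    define d where "d = ?D"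
    have "d \<noteq> 0" using D by (simp add: d_def)
    then show ?thesis
      unfolding d_def[symmetric] power_mult_distrib using q
      by (simp add: divide_simps power2_eq_square power3_eq_cube) (simp add: algebra_simps)
  qed
  also have "\<dots> = - of_real ?C / ?D * ?rhs"
    unfolding Q1_polynomial_identity[OF tS]
    by (simp add: S_def t_def K_def q_def algebra_simps)
  finally show ?thesis .
qed

text \<open>The substitution x = y/s contributes 1/s, which lowers the power s^3 of the integrand to
  s^2.\<close>

lemma Q1_tilde_eq:
  assumes "s > 0"
  shows "Q1_tilde (s\<^sup>2) (s * k) =
    - of_real (sqrt 2 * s\<^sup>2 / (sqrt (2 * pi)) ^ 3) / (of_real \<bar>s * k\<bar> + \<i> * of_real s)\<^sup>2
    * of_real ((k\<^sup>2 - 1) * k\<^sup>2 * (k\<^sup>2 + 1) / 12 * (pi * sech (pi / 2 * k)))"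
proof -
  define F where "F = (\<lambda>x. fst (Q1 (s\<^sup>2) x) * cnj (Psi1 (s\<^sup>2) x (s * k))
    - snd (Q1 (s\<^sup>2) x) * cnj (Psi2 (s\<^sup>2) x (s * k)))"
  have "Q1_tilde (s\<^sup>2) (s * k) = (1 / s) *\<^sub>R (LINT y|lborel. F (y / s))"
    using assms lborel_integral_real_affine[of "1 / s" F 0]
    by (simp add: Q1_tilde_def distFT_plus_def F_def)
  also have "(LINT y|lborel. F (y / s)) =
      - of_real (sqrt 2 * s ^ 3 / (sqrt (2 * pi)) ^ 3) / (of_real \<bar>s * k\<bar> + \<i> * of_real s)\<^sup>2 *
      (((of_real k)\<^sup>2 - 1) * FT (\<lambda>x. sech x ^ 1) k + (5 - 4 * (of_real k)\<^sup>2) * FT (\<lambda>x. sech x ^ 3) k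
      + (3 * (of_real k)\<^sup>2 - 9) * FT (\<lambda>x. sech x ^ 5) k + 6 * FT (\<lambda>x. sech x ^ 7) k
      - 2 * \<i> * of_real k * (FT (\<lambda>x. tanh x * sech x ^ 1) k
        - 4 * FT (\<lambda>x. tanh x * sech x ^ 3) k + 3 * FT (\<lambda>x. tanh x * sech x ^ 5) k))"
    \<comment> \<open>Integrability and value are carried together through the linear combination,
      down to the individual sech integrals.\<close>
    unfolding F_def Q1_tilde_integrand[OF assms] FT_def
    by (intro has_bochner_integral_integral_eq has_bochner_integral_mult_right
        has_bochner_integral_add has_bochner_integral_diff has_bochner_integral_integrable
        integrable_FT_sech) simp_all
  finally show ?thesis
    unfolding FT_sech_combination using assms
    by (simp add: scaleR_conv_of_real power2_eq_square power3_eq_cube)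
qed

section \<open>The closed formula and its zeros\<close>

theorem lemma5p4:
  fixes \<omega> :: real
  assumes "0 < \<omega>"
  shows "(\<forall>\<xi>::real.
            Q1_tilde \<omega> \<xi> =
              complex_of_real (\<omega> - \<xi>\<^sup>2)
              * complex_of_real (1 / (24 * sqrt pi))
              * (complex_of_real (\<xi>\<^sup>2 * (\<omega> + \<xi>\<^sup>2))
                 / (complex_of_real (\<omega>\<^sup>2)
                    * (complex_of_real \<bar>\<xi>\<bar> + \<i> * complex_of_real (sqrt \<omega>))\<^sup>2))
              * complex_of_real (sech (pi / 2 * (\<xi> / sqrt \<omega>))))
         \<and> Q1_tilde \<omega> (sqrt \<omega>) = 0
         \<and> Q1_tilde \<omega> (- sqrt \<omega>) = 0"
proof -
  define s where "s = sqrt \<omega>"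
  have s: "s > 0" "\<omega> = s\<^sup>2" "sqrt \<omega> = s"
    using assms by (simp_all add: s_def)
  have main: "Q1_tilde \<omega> \<xi> =
              complex_of_real (\<omega> - \<xi>\<^sup>2)
              * complex_of_real (1 / (24 * sqrt pi))
              * (complex_of_real (\<xi>\<^sup>2 * (\<omega> + \<xi>\<^sup>2))
                 / (complex_of_real (\<omega>\<^sup>2)
                    * (complex_of_real \<bar>\<xi>\<bar> + \<i> * complex_of_real (sqrt \<omega>))\<^sup>2))
              * complex_of_real (sech (pi / 2 * (\<xi> / sqrt \<omega>)))" for \<xi>
  proof -
    define k where "k = \<xi> / s"
    have \<xi>: "\<xi> = s * k"
      using s(1) by (simp add: k_def)
    let ?D = "(complex_of_real \<bar>s * k\<bar> + \<i> * complex_of_real s)\<^sup>2"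
    have "(sqrt (2 * pi)) ^ 3 = (sqrt (2 * pi))\<^sup>2 * sqrt (2 * pi)"
      by (simp only: power3_eq_cube power2_eq_square)
    then have "(sqrt (2 * pi)) ^ 3 = 2 * pi * (sqrt 2 * sqrt pi)"
      by (simp add: real_sqrt_mult power_mult_distrib)
    \<comment> \<open>The constant is sqrt 2 pi / (12 * 2 pi sqrt 2 sqrt pi) = 1/(24 sqrt pi). The
      minus sign turns k^2 - 1 into 1 - k^2, and one factor s^2 for each of 1 - k^2, k^2 and 1 + k^2
      is balanced by the prefactor s^2 and the denominator s^4 = \<omega>^2.\<close>
    then have real: "- (sqrt 2 * s\<^sup>2 / (sqrt (2 * pi)) ^ 3)
        * ((k\<^sup>2 - 1) * k\<^sup>2 * (k\<^sup>2 + 1) / 12 * (pi * sech (pi / 2 * k)))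
      = (s\<^sup>2 - (s * k)\<^sup>2) * (1 / (24 * sqrt pi)) * ((s * k)\<^sup>2 * (s\<^sup>2 + (s * k)\<^sup>2) / (s\<^sup>2)\<^sup>2)
        * sech (pi / 2 * k)"
      using s(1) by (simp add: field_simps power2_eq_square)
    have "Q1_tilde \<omega> \<xi> = of_real (- (sqrt 2 * s\<^sup>2 / (sqrt (2 * pi)) ^ 3)
        * ((k\<^sup>2 - 1) * k\<^sup>2 * (k\<^sup>2 + 1) / 12 * (pi * sech (pi / 2 * k)))) / ?D"
      unfolding s(2) \<xi> Q1_tilde_eq[OF s(1)] of_real_mult of_real_minus
      by (simp only: times_divide_eq_left)
    then show ?thesis
      unfolding real s(3) unfolding s(2) \<xi> using s(1)
      by (simp add: mult_ac)
  qed
  moreover have "Q1_tilde \<omega> (sqrt \<omega>) = 0" "Q1_tilde \<omega> (- sqrt \<omega>) = 0"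
    unfolding main using assms by simp_all
  ultimately show ?thesis
    by blast
qed

end
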